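(* Let $k \geq 3$, let $\sigma \in S_k$, and let $n \geq 1$. The periodic points of the map $SC_\sigma : S_n \to S_n$ are precisely the permutations in $\mathrm{Av}_n(\underline{\sigma}, \underline{\mathrm{rev}(\sigma)})$. That is, for $\pi \in S_n$, there exists $p \geq 1$ with $SC_\sigma^p(\pi) = \pi$ if and only if $\pi$ contains no consecutive occurrence of $\sigma$ and no consecutive occurrence of $\mathrm{rev}(\sigma)$.
   Context: $S_n$ is the set of permutations of $\{1,\dots,n\}$, written as sequences $\pi = (\pi(1),\dots,\pi(n))$. For $\sigma \in S_k$, $\mathrm{rev}(\sigma) = (\sigma(k), \sigma(k-1), \dots, \sigma(1))$. A sequence of distinct integers contains a consecutive occurrence of $\sigma \in S_k$ (an occurrence of $\underline{\sigma}$) if some $k$ entries in consecutive positions are in the same relative order as $\sigma$. $\mathrm{Av}_n(\underline{\sigma}, \underline{\mathrm{rev}(\sigma)})$ is the set of permutations in $S_n$ containing no consecutive occurrence of $\sigma$ and no consecutive occurrence of $\mathrm{rev}(\sigma)$. The map $SC_\sigma : S_n \to S_n$ is defined by the following procedure on an input permutation $\pi$, with an initially empty stack and an initially empty output. "Push" removes the first remaining entry of the input and places it on top of the stack; "pop" removes the top entry of the stack and appends it to the end of the output. At each step, if input entries remain and pushing the next input entry would not create a consecutive occurrence of $\sigma$ in the stack read from top to bottom, push; otherwise, pop. The procedure ends when the input and the stack are empty, and $SC_\sigma(\pi)$ is the resulting output. $SC_\sigma^p$ denotes the $p$-fold iterate. *)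

theory Defs
  imports "HOL-Combinatorics.Multiset_Permutations" "HOL-Library.Sublist"
begin

text \<open>Permutations of \<open>{1..n}\<close> in one-line notation: \<open>\<pi>(i)\<close> is the list entry \<open>\<pi> ! (i - 1)\<close>.
  The reversal of \<open>\<sigma>\<close> is thus \<open>rev \<sigma>\<close>.\<close>

abbreviation perms :: "nat \<Rightarrow> nat list set" where
  "perms n \<equiv> permutations_of_set {1..n}"

definition same_relative_order :: "nat list \<Rightarrow> nat list \<Rightarrow> bool" where
  "same_relative_order xs ys \<longleftrightarrow> length xs = length ys \<and>
     (\<forall>i<length xs. \<forall>j<length xs. xs ! i < xs ! j \<longleftrightarrow> ys ! i < ys ! j)"

definition contains_consecutive :: "nat list \<Rightarrow> nat list \<Rightarrow> bool" where
  "contains_consecutive \<sigma> xs \<longleftrightarrow> (\<exists>ys. sublist ys xs \<and> same_relative_order ys \<sigma>)"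

definition Av :: "nat \<Rightarrow> nat list set \<Rightarrow> nat list set" where
  "Av n P = {\<pi> \<in> perms n. \<forall>\<sigma>\<in>P. \<not> contains_consecutive \<sigma> \<pi>}"

text \<open>The arguments of \<open>stack_run \<sigma>\<close> are the remaining input, the stack (head = top) and the
  output so far. The stack is pattern-free at every stage, so a push creates an occurrence of \<open>\<sigma>\<close>
  iff the enlarged stack contains one. With an empty stack no pop is possible and the entry is
  pushed; for patterns of length at least 2, this agrees with the test, since a one-element stack
  contains no occurrence.\<close>

function stack_run :: "nat list \<Rightarrow> nat list \<Rightarrow> nat list \<Rightarrow> nat list \<Rightarrow> nat list" where
  "stack_run \<sigma> [] [] out = out"
| "stack_run \<sigma> [] (s # st) out = stack_run \<sigma> [] st (out @ [s])"
| "stack_run \<sigma> (x # inp) [] out = stack_run \<sigma> inp [x] out"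
| "stack_run \<sigma> (x # inp) (s # st) out =
     (if \<not> contains_consecutive \<sigma> (x # s # st)
      then stack_run \<sigma> inp (x # s # st) out
      else stack_run \<sigma> (x # inp) st (out @ [s]))"
  by pat_completeness auto
termination
  by (relation "measure (\<lambda>(\<sigma>, inp, st, out). 2 * length inp + length st)") auto

definition SC :: "nat list \<Rightarrow> nat list \<Rightarrow> nat list" where
  "SC \<sigma> \<pi> = stack_run \<sigma> \<pi> [] []"

lemma mset_stack_run: "mset (stack_run \<sigma> inp st out) = mset inp + mset st + mset out"
  by (induction \<sigma> inp st out rule: stack_run.induct) auto

lemma SC_in_perms:
  assumes "\<pi> \<in> perms n"
  shows "SC \<sigma> \<pi> \<in> perms n"
proof -
  have "mset (SC \<sigma> \<pi>) = mset \<pi>"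
    by (simp add: SC_def mset_stack_run)
  then have "set (SC \<sigma> \<pi>) = set \<pi>" and "distinct (SC \<sigma> \<pi>) \<longleftrightarrow> distinct \<pi>"
    by (metis mset_eq_setD, metis mset_eq_imp_distinct_iff)
  with assms show ?thesis
    by (simp add: permutations_of_set_def)
qed

definition periodic_points :: "('a \<Rightarrow> 'a) \<Rightarrow> 'a set \<Rightarrow> 'a set" where
  "periodic_points f A = {x \<in> A. \<exists>p\<ge>1. (f ^^ p) x = x}"

end

theory Submission
  imports Defs
begin

text \<open>
  Call a pop premature if it happens while input remains. The output of \<open>SC \<sigma>\<close> on \<open>\<pi>\<close> is the list
  of prematurely popped entries, followed by the other entries in the reverse of their order in
  \<open>\<pi>\<close> (\<open>SC_split\<close>). The stack read from top to bottom is a reversed part of \<open>\<pi>\<close>, so premature pops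
  occur iff \<open>\<pi>\<close> contains \<open>rev \<sigma>\<close> (\<open>popped_Nil_iff\<close>). A permutation that avoids both \<open>\<sigma>\<close> and
  \<open>rev \<sigma>\<close> is therefore reversed by \<open>SC \<sigma>\<close>, and so is its reversal: it has period dividing 2.
  Conversely, if no element of a cycle has a premature pop, then every step of the cycle is a
  reversal and the elements of the cycle avoid both patterns. It remains to show that premature
  pops never occur along a cycle.

  Assume they do. Call an entry mobile if it is popped prematurely at some time in the cycle; the
  others form the frame. A step reverses the frame, and a prematurely popped entry comes out before
  the whole frame. Steps without a premature pop of an entry only reverse its position relative to
  the frame. Going once around the cycle shows that at every time each mobile entry is before the
  whole frame or after the whole frame (\<open>mobile_outer\<close>).

  Up to reversing the order of the values, \<open>\<sigma>\<close> begins with an ascent. Suppose \<open>a\<close> is popped because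
  of the input entry \<open>x\<close>, and let \<open>b\<close> be the stack entry below \<open>a\<close>; then \<open>x, a, b\<close> are ordered like
  the first three entries of \<open>\<sigma>\<close>, in particular \<open>x < a\<close>. If \<open>a\<close> is the least mobile entry, then \<open>x\<close>
  lies in the frame, so \<open>a\<close> is before the whole frame; hence \<open>b\<close>, which precedes \<open>a\<close>, is
  mobile, and \<open>a < b\<close> by minimality. So the second step of \<open>\<sigma>\<close> is an ascent as well
  (\<open>pattern_second_ascent\<close>), and every premature pop has \<open>x < a < b\<close>.

  Now let \<open>a\<close> be the greatest mobile entry \<open>\<mu>\<close>. From \<open>\<mu> < b\<close> it follows that \<open>b\<close> is in the frame. An
  entry pushed onto \<open>b\<close> was either next to \<open>b\<close> in the input or has just popped an entry from \<open>b\<close>;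
  an entry popped by \<open>\<mu>\<close> would be mobile and greater than \<open>\<mu>\<close>, so \<open>b\<close> and \<open>\<mu>\<close> are adjacent in the
  input of a step that pops \<open>\<mu>\<close>. The popping entry \<open>x\<close> separates them in the output. By the same
  reasoning about neighbours in the stack, later steps cannot make them adjacent again, which
  contradicts periodicity (\<open>mobile_empty\<close>).
\<close>

section \<open>The order of entries in a list\<close>

definition precedes :: "'a list \<Rightarrow> 'a \<Rightarrow> 'a \<Rightarrow> bool" where
  "precedes xs u v \<longleftrightarrow> (\<exists>ys zs. xs = ys @ zs \<and> u \<in> set ys \<and> v \<in> set zs)"

lemma precedes_append: "u \<in> set xs \<Longrightarrow> v \<in> set ys \<Longrightarrow> precedes (xs @ ys) u v"
  unfolding precedes_def by blast

lemma precedes_in_set: "precedes xs u v \<Longrightarrow> u \<in> set xs \<and> v \<in> set xs"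
  unfolding precedes_def by auto

lemma precedes_asym:
  assumes "distinct xs" and "precedes xs u v"
  shows "\<not> precedes xs v u"
proof
  assume "precedes xs v u"
  then obtain ys' zs' where 2: "xs = ys' @ zs'" "v \<in> set ys'" "u \<in> set zs'"
    unfolding precedes_def by blast
  obtain ys zs where 1: "xs = ys @ zs" "u \<in> set ys" "v \<in> set zs"
    using assms(2) unfolding precedes_def by blast
  from 1 2 have "ys @ zs = ys' @ zs'" by simp
  then show False
    using 1 2 assms(1) by (auto simp: append_eq_append_conv2)
qed

lemma precedes_trans:
  assumes "distinct xs" and "precedes xs u v" and "precedes xs v w"
  shows "precedes xs u w"
proof -
  obtain ys zs where 1: "xs = ys @ zs" "u \<in> set ys" "v \<in> set zs"
    using assms(2) unfolding precedes_def by blast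
  have "w \<notin> set ys"
    using precedes_append[of w ys v zs] 1 precedes_asym[OF assms(1,3)] by blast
  then have "w \<in> set zs" using precedes_in_set[OF assms(3)] 1(1) by auto
  then show ?thesis using 1 by (auto intro: precedes_append)
qed

lemma precedes_rev: "precedes (rev xs) u v \<longleftrightarrow> precedes xs v u"
proof -
  have "precedes (rev xs) u v" if "precedes xs v u" for xs :: "'a list" and u v
    using that unfolding precedes_def by (metis rev_append set_rev)
  from this[of xs v u] this[of "rev xs" u v] show ?thesis by auto
qed

lemma precedes_Nil: "\<not> precedes [] u v"
  unfolding precedes_def by simp

lemma precedes_Cons: "precedes (x # xs) u v \<longleftrightarrow> u = x \<and> v \<in> set xs \<or> precedes xs u v"
proof
  assume "precedes (x # xs) u v"
  then show "u = x \<and> v \<in> set xs \<or> precedes xs u v"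
    unfolding precedes_def by (auto simp: Cons_eq_append_conv)
next
  assume "u = x \<and> v \<in> set xs \<or> precedes xs u v"
  then show "precedes (x # xs) u v"
  proof
    assume "u = x \<and> v \<in> set xs"
    then show ?thesis using precedes_append[of u "[x]" v xs] by simp
  next
    assume "precedes xs u v"
    then show ?thesis unfolding precedes_def by (metis append_Cons list.set_intros(2))
  qed
qed

lemma precedes_filter:
  "precedes (filter P xs) u v \<longleftrightarrow> precedes xs u v \<and> P u \<and> P v"
  by (induction xs) (auto simp: precedes_Nil precedes_Cons)

lemma precedes_appendD:
  assumes "distinct (xs @ ys)" and "precedes (xs @ ys) u v" and "u \<in> set ys"
  shows "precedes ys u v"
proof -
  have "filter (\<lambda>w. w \<in> set ys) xs = []"
    using assms(1) by (auto simp: filter_empty_conv)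
  moreover have "filter (\<lambda>w. w \<in> set ys) ys = ys"
    by (simp add: filter_id_conv)
  ultimately have ys: "ys = filter (\<lambda>w. w \<in> set ys) (xs @ ys)" by simp
  have "v \<notin> set xs"
    using assms precedes_append[of v xs u ys] precedes_asym by metis
  then have "v \<in> set ys" using precedes_in_set[OF assms(2)] by auto
  then show ?thesis
    using assms precedes_filter[of "\<lambda>w. w \<in> set ys" "xs @ ys"] ys by metis
qed

lemma sublist_pair_precedes: "sublist [u, v] xs \<Longrightarrow> precedes xs u v"
  unfolding sublist_def precedes_def by (metis append.assoc append_Cons append_Nil in_set_conv_decomp)

lemma sublist_pair_next:
  assumes "distinct xs" and "sublist [u, v] xs" and "precedes xs u w" and "w \<noteq> v"
  shows "precedes xs v w"
proof -
  obtain ps ss where xs: "xs = ps @ [u, v] @ ss" using assms(2) unfolding sublist_def by blast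
  have "w \<notin> set ps"
    using precedes_append[of w ps u "[u, v] @ ss"] xs precedes_asym[OF assms(1,3)] by auto
  moreover have "w \<noteq> u" using assms(1,3) precedes_asym by metis
  ultimately have "w \<in> set ss" using precedes_in_set[OF assms(3)] xs assms(4) by auto
  then show ?thesis using xs precedes_append[of v "ps @ [u, v]" w ss] by simp
qed

lemma sublist_pair_append_right:
  assumes "distinct (xs @ ys)" and "sublist [u, v] (xs @ ys)" and "u \<in> set ys"
  shows "sublist [u, v] ys"
proof -
  have "u \<notin> set xs" using assms(1,3) by auto
  then have "\<not> sublist [u, v] xs" by (meson list.set_intros(1) set_mono_sublist subsetD)
  moreover have "\<not> (ws \<noteq> [] \<and> suffix ws xs)" if "[u, v] = ws @ ws'" for ws ws'
    using that \<open>u \<notin> set xs\<close> by (cases ws) (auto simp: suffix_def)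
  ultimately show ?thesis
    using assms(2) unfolding sublist_append by (metis append_Nil prefix_imp_sublist)
qed

section \<open>Consecutive patterns\<close>

lemma same_relative_order_rev:
  assumes "same_relative_order xs ys"
  shows "same_relative_order (rev xs) (rev ys)"
  using assms unfolding same_relative_order_def by (auto simp: rev_nth)

lemma same_relative_order_take:
  "same_relative_order xs ys \<Longrightarrow> same_relative_order (take j xs) (take j ys)"
  unfolding same_relative_order_def by auto

lemma contains_consecutive_rev: "contains_consecutive (rev \<sigma>) xs \<longleftrightarrow> contains_consecutive \<sigma> (rev xs)"
proof -
  have "contains_consecutive (rev \<sigma>) (rev xs)" if "contains_consecutive \<sigma> xs" for \<sigma> xs
    using that same_relative_order_rev unfolding contains_consecutive_def
    by (meson sublist_rev)
  from this[of \<sigma> "rev xs"] this[of "rev \<sigma>" xs] show ?thesis by auto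
qed

lemma contains_consecutive_append: "contains_consecutive \<sigma> ys \<Longrightarrow> contains_consecutive \<sigma> (xs @ ys)"
  unfolding contains_consecutive_def by (meson sublist_append)

lemma contains_consecutive_length: "contains_consecutive \<sigma> xs \<Longrightarrow> length \<sigma> \<le> length xs"
  unfolding contains_consecutive_def same_relative_order_def by (metis sublist_length_le)

text \<open>An occurrence that avoids the new top \<open>x\<close> would already lie in \<open>st\<close>.\<close>

lemma new_occurrence_take:
  assumes "contains_consecutive \<sigma> (x # st)" and "\<not> contains_consecutive \<sigma> st"
  shows "same_relative_order (take (length \<sigma>) (x # st)) \<sigma>"
proof -
  obtain ys where ys: "sublist ys (x # st)" "same_relative_order ys \<sigma>"
    using assms(1) unfolding contains_consecutive_def by blast
  then have "prefix ys (x # st)"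
    using assms(2) unfolding contains_consecutive_def sublist_Cons_right by blast
  moreover have "length ys = length \<sigma>" using ys(2) by (simp add: same_relative_order_def)
  ultimately have "ys = take (length \<sigma>) (x # st)" by (auto simp: prefix_def)
  with ys(2) show ?thesis by simp
qed

text \<open>The comparison of three entries suffices for the analysis of pops. For patterns of length 2
  there would be no information about \<open>b\<close>, and \<open>s\<close> could be the only stack entry.\<close>

lemma new_occurrence_top:
  assumes "contains_consecutive \<sigma> (x # s # st)" and "\<not> contains_consecutive \<sigma> (s # st)"
    and "length \<sigma> \<ge> 3"
  obtains b st' where "st = b # st'" and "same_relative_order [x, s, b] (take 3 \<sigma>)"
proof -
  have "length \<sigma> \<le> length (x # s # st)" using assms(1) contains_consecutive_length by blast
  then obtain b st' where st: "st = b # st'" using assms(3) by (cases st) auto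
  have "same_relative_order (take 3 (take (length \<sigma>) (x # s # st))) (take 3 \<sigma>)"
    using new_occurrence_take[OF assms(1,2)] same_relative_order_take by blast
  then have "same_relative_order [x, s, b] (take 3 \<sigma>)"
    using assms(3) st by (simp add: numeral_3_eq_3 min_def)
  with st that show thesis by blast
qed

section \<open>Runs of the stack\<close>

text \<open>The entries that are popped while input remains, in the order of their removal. The
  recursion follows \<open>stack_run\<close>, but stops when the input is exhausted.\<close>

function popped :: "nat list \<Rightarrow> nat list \<Rightarrow> nat list \<Rightarrow> nat list" where
  "popped \<sigma> [] st = []"
| "popped \<sigma> (x # inp) [] = popped \<sigma> inp [x]"
| "popped \<sigma> (x # inp) (s # st) =
     (if \<not> contains_consecutive \<sigma> (x # s # st)
      then popped \<sigma> inp (x # s # st)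
      else s # popped \<sigma> (x # inp) st)"
  by pat_completeness auto
termination
  by (relation "measure (\<lambda>(\<sigma>, inp, st). 2 * length inp + length st)") auto

text \<open>The states (remaining input, stack, output) that occur before the final emptying of the
  stack; thus all of the output component was popped prematurely. Facts about a run become
  invariants of this relation.\<close>

inductive reach :: "nat list \<Rightarrow> nat list \<Rightarrow> nat list \<Rightarrow> nat list \<Rightarrow> nat list \<Rightarrow> bool"
  for \<sigma> \<pi> :: "nat list" where
  start: "reach \<sigma> \<pi> \<pi> [] []"
| first: "reach \<sigma> \<pi> (x # inp) [] out \<Longrightarrow> reach \<sigma> \<pi> inp [x] out"
| push: "reach \<sigma> \<pi> (x # inp) (s # st) out \<Longrightarrow> \<not> contains_consecutive \<sigma> (x # s # st)
    \<Longrightarrow> reach \<sigma> \<pi> inp (x # s # st) out"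
| pop: "reach \<sigma> \<pi> (x # inp) (s # st) out \<Longrightarrow> contains_consecutive \<sigma> (x # s # st)
    \<Longrightarrow> reach \<sigma> \<pi> (x # inp) st (out @ [s])"

lemma reach_stack_run: "reach \<sigma> \<pi> inp st out \<Longrightarrow> stack_run \<sigma> inp st out = SC \<sigma> \<pi>"
  by (induction rule: reach.induct) (auto simp: SC_def)

lemma mset_SC: "mset (SC \<sigma> \<pi>) = mset \<pi>"
  by (simp add: SC_def mset_stack_run)

lemma set_SC: "set (SC \<sigma> \<pi>) = set \<pi>"
  by (rule mset_eq_setD[OF mset_SC])

lemma distinct_SC: "distinct (SC \<sigma> \<pi>) \<longleftrightarrow> distinct \<pi>"
  by (rule mset_eq_imp_distinct_iff[OF mset_SC])

lemma reach_popped: "reach \<sigma> \<pi> inp st out \<Longrightarrow> out @ popped \<sigma> inp st = popped \<sigma> \<pi> []"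
  by (induction rule: reach.induct) auto

lemma reach_end: "\<exists>st out. reach \<sigma> \<pi> [] st out"
proof -
  have "reach \<sigma> \<pi> inp st out \<Longrightarrow> \<exists>st out. reach \<sigma> \<pi> [] st out" for inp st out
  proof (induction \<sigma> inp st out rule: stack_run.induct)
    case (4 \<sigma> x inp s st out)
    then show ?case by (meson reach.push reach.pop)
  qed (blast intro: reach.first)+
  then show ?thesis by (blast intro: reach.start)
qed

lemma stack_run_empty_input: "stack_run \<sigma> [] st out = out @ st"
  by (induction st arbitrary: out) auto

lemma stack_run_split: "\<exists>zs. stack_run \<sigma> inp st out = out @ zs"
  by (induction \<sigma> inp st out rule: stack_run.induct) auto

lemma reach_no_occurrence:
  assumes "reach \<sigma> \<pi> inp st out" and "length \<sigma> \<ge> 2"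
  shows "\<not> contains_consecutive \<sigma> st"
  using assms
proof (induction rule: reach.induct)
  case start
  then show ?case using contains_consecutive_length by fastforce
next
  case (first x inp out)
  then show ?case using contains_consecutive_length[of \<sigma> "[x]"] by auto
next
  case (pop x inp s st out)
  then show ?case using contains_consecutive_append[of \<sigma> st "[s]"] by auto
qed auto

text \<open>Once popped, an entry never returns to the stack, and the remaining entries keep their order.\<close>

lemma reach_stack:
  assumes "reach \<sigma> \<pi> inp st out" and "distinct \<pi>"
  shows "\<exists>ps. \<pi> = ps @ inp \<and> set out \<subseteq> set ps \<and> st = filter (\<lambda>v. v \<notin> set out) (rev ps)"
  using assms
proof (induction rule: reach.induct)
  case start
  then show ?case by simp
next
  case (first x inp out)
  then obtain ps where ps: "\<pi> = ps @ x # inp" "set out \<subseteq> set ps"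
    "[] = filter (\<lambda>v. v \<notin> set out) (rev ps)" by blast
  then have "x \<notin> set out" using first.prems by auto
  then show ?case using ps by (intro exI[of _ "ps @ [x]"]) auto
next
  case (push x inp s st out)
  then obtain ps where ps: "\<pi> = ps @ x # inp" "set out \<subseteq> set ps"
    "s # st = filter (\<lambda>v. v \<notin> set out) (rev ps)" by blast
  then have "x \<notin> set out" using push.prems by auto
  then show ?case using ps by (intro exI[of _ "ps @ [x]"]) auto
next
  case (pop x inp s st out)
  then obtain ps where ps: "\<pi> = ps @ x # inp" "set out \<subseteq> set ps"
    "s # st = filter (\<lambda>v. v \<notin> set out) (rev ps)" by blast
  have "distinct (s # st)" using ps pop.prems by (metis distinct_append distinct_filter distinct_rev)
  then have "st = filter (\<lambda>v. v \<noteq> s) (s # st)" by (auto intro!: filter_True[symmetric])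
  also have "\<dots> = filter (\<lambda>v. v \<notin> set (out @ [s])) (rev ps)"
    unfolding ps(3) filter_filter by (rule filter_cong) auto
  finally have "st = filter (\<lambda>v. v \<notin> set (out @ [s])) (rev ps)" .
  moreover have "s \<in> set ps" using ps(3) by (metis filter_is_subset list.set_intros(1) set_rev subsetD)
  ultimately show ?case using ps by auto
qed

lemma SC_split:
  assumes "distinct \<pi>"
  shows "SC \<sigma> \<pi> = popped \<sigma> \<pi> [] @ filter (\<lambda>v. v \<notin> set (popped \<sigma> \<pi> [])) (rev \<pi>)"
proof -
  obtain st out where r: "reach \<sigma> \<pi> [] st out" using reach_end by blast
  have "SC \<sigma> \<pi> = out @ st" using reach_stack_run[OF r] stack_run_empty_input by simp
  moreover have "out = popped \<sigma> \<pi> []" using reach_popped[OF r] by simp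
  moreover have "st = filter (\<lambda>v. v \<notin> set out) (rev \<pi>)" using reach_stack[OF r assms] by auto
  ultimately show ?thesis by simp
qed

text \<open>The two ways in which \<open>x\<close> can come to lie directly on \<open>s\<close> in the stack: either \<open>s\<close> was pushed
  immediately before \<open>x\<close>, or the last operation before the push of \<open>x\<close> removed an entry \<open>y\<close> lying
  on \<open>s\<close>, and then \<open>x, y, s\<close> began an occurrence of \<open>\<sigma>\<close>. The set \<open>Y\<close> is the range of \<open>y\<close>.\<close>

definition stack_link :: "nat list \<Rightarrow> nat list \<Rightarrow> nat set \<Rightarrow> nat \<Rightarrow> nat \<Rightarrow> bool" where
  "stack_link \<sigma> \<pi> Y s x \<longleftrightarrow>
     sublist [s, x] \<pi> \<or> (\<exists>y\<in>Y. same_relative_order [x, y, s] (take 3 \<sigma>))"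

lemma stack_link_mono: "stack_link \<sigma> \<pi> Y s x \<Longrightarrow> Y \<subseteq> Z \<Longrightarrow> stack_link \<sigma> \<pi> Z s x"
  unfolding stack_link_def by blast

lemma reach_input_suffix: "reach \<sigma> \<pi> inp st out \<Longrightarrow> suffix inp \<pi>"
  by (induction rule: reach.induct) (auto dest: suffix_ConsD)

text \<open>The second conjunct anticipates the next push. It is needed for the induction, because a
  state does not record its last operation.\<close>

lemma reach_link_aux:
  assumes "reach \<sigma> \<pi> inp st out" and "length \<sigma> \<ge> 3"
  shows "(\<forall>u v. sublist [u, v] st \<longrightarrow> stack_link \<sigma> \<pi> (set out) v u) \<and>
    (\<forall>s st' x inp'. st = s # st' \<longrightarrow> inp = x # inp' \<longrightarrow> stack_link \<sigma> \<pi> (set out) s x)"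
proof -
  have adj: "stack_link \<sigma> \<pi> Y x x'" if "reach \<sigma> \<pi> (x # x' # inp) st out" for x x' inp st out Y
  proof -
    have "suffix ([x, x'] @ inp) \<pi>" using reach_input_suffix[OF that] by simp
    then show ?thesis unfolding stack_link_def sublist_def suffix_def by blast
  qed
  show ?thesis
    using assms
  proof (induction rule: reach.induct)
    case start
    then show ?case by simp
  next
    case (first x inp out)
    then show ?case using adj by (auto simp: sublist_Cons_right)
  next
    case (push x inp s st out)
    then show ?case using adj by (auto simp: sublist_Cons_right[of _ x])
  next
    case (pop x inp s st out)
    obtain b st' where b: "st = b # st'" "same_relative_order [x, s, b] (take 3 \<sigma>)"
      using new_occurrence_top[OF pop.hyps(2)] reach_no_occurrence[OF pop.hyps(1)] pop.prems
      by (metis Suc_leD eval_nat_numeral(3))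
    have "stack_link \<sigma> \<pi> (set (out @ [s])) v u" if "sublist [u, v] st" for u v
    proof -
      have "sublist [u, v] (s # st)" using that by (simp add: sublist_Cons_right)
      then have "stack_link \<sigma> \<pi> (set out) v u" using pop.IH pop.prems by blast
      then show ?thesis by (rule stack_link_mono) auto
    qed
    moreover have "stack_link \<sigma> \<pi> (set (out @ [s])) b x"
      using b(2) unfolding stack_link_def by auto
    ultimately show ?case using b(1) by blast
  qed
qed

text \<open>Unpopped neighbours in the output were neighbours in the stack when the input ran out.\<close>

lemma SC_link:
  assumes "distinct \<pi>" and "length \<sigma> \<ge> 3" and "sublist [u, v] (SC \<sigma> \<pi>)"
    and "u \<notin> set (popped \<sigma> \<pi> [])"
  shows "stack_link \<sigma> \<pi> (set (popped \<sigma> \<pi> [])) v u"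
proof -
  obtain st out where r: "reach \<sigma> \<pi> [] st out" using reach_end by blast
  have out: "out = popped \<sigma> \<pi> []" using reach_popped[OF r] by simp
  have SC: "SC \<sigma> \<pi> = out @ st" using reach_stack_run[OF r] stack_run_empty_input by simp
  have "distinct (SC \<sigma> \<pi>)" using assms(1) by (simp add: distinct_SC)
  moreover have "u \<in> set st"
    using assms(3,4) SC out by (metis Un_iff list.set_intros(1) set_append set_mono_sublist subsetD)
  ultimately have "sublist [u, v] st"
    using sublist_pair_append_right[of out st u v] assms(3) SC by simp
  then show ?thesis using reach_link_aux[OF r assms(2)] out by blast
qed

text \<open>All that the main argument needs to know about a premature pop of \<open>a\<close>: here \<open>x\<close> is the input
  entry that forces the pop and \<open>b\<close> the stack entry below \<open>a\<close>. The entry \<open>x\<close> is still in the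
  input when \<open>a\<close> is written to the output, hence comes after \<open>a\<close> there, too.\<close>

lemma popped_event:
  assumes "distinct \<pi>" and "length \<sigma> \<ge> 3" and "a \<in> set (popped \<sigma> \<pi> [])"
  obtains x b where "same_relative_order [x, a, b] (take 3 \<sigma>)"
    and "precedes \<pi> b a" and "precedes \<pi> a x" and "precedes (SC \<sigma> \<pi>) a x"
    and "stack_link \<sigma> \<pi> (set (popped \<sigma> \<pi> [])) b a"
proof -
  have "\<exists>x inp st out'. reach \<sigma> \<pi> (x # inp) (a # st) out' \<and> contains_consecutive \<sigma> (x # a # st)"
    if "reach \<sigma> \<pi> inp st out" "a \<in> set out" for inp st out
    using that by (induction rule: reach.induct) auto
  moreover obtain st out where r: "reach \<sigma> \<pi> [] st out" using reach_end by blast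
  moreover have "out = popped \<sigma> \<pi> []" using reach_popped[OF r] by simp
  ultimately obtain x inp st out where
    r: "reach \<sigma> \<pi> (x # inp) (a # st) out" and c: "contains_consecutive \<sigma> (x # a # st)"
    using assms(3) by blast
  obtain b st' where b: "st = b # st'" "same_relative_order [x, a, b] (take 3 \<sigma>)"
    using new_occurrence_top[OF c] reach_no_occurrence[OF r] assms(2)
    by (metis Suc_leD eval_nat_numeral(3))
  obtain ps where ps: "\<pi> = ps @ x # inp" "set out \<subseteq> set ps"
      "a # st = filter (\<lambda>v. v \<notin> set out) (rev ps)"
    using reach_stack[OF r assms(1)] by blast
  have "a \<in> set ps"
    using ps(3) by (metis filter_is_subset list.set_intros(1) set_rev subsetD)
  then have ax: "precedes \<pi> a x" unfolding ps(1) by (intro precedes_append) auto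
  have "precedes (a # st) a b" using precedes_append[of a "[a]" b st] b(1) by simp
  then have "precedes ps b a" unfolding ps(3) precedes_filter precedes_rev by simp
  then have ba: "precedes \<pi> b a" unfolding ps(1) precedes_def by (metis Un_iff append.assoc set_append)
  obtain zs where SC: "SC \<sigma> \<pi> = (out @ [a]) @ zs"
    using reach_stack_run[OF reach.pop[OF r c]] stack_run_split by metis
  have "x \<notin> set (out @ [a])" using ps(1,2) assms(1) \<open>a \<in> set ps\<close> by auto
  then have "x \<in> set zs" using SC ps(1) set_SC[of \<sigma> \<pi>] by auto
  then have ax': "precedes (SC \<sigma> \<pi>) a x" unfolding SC by (intro precedes_append) auto
  have "sublist [a, b] (a # st)" using b(1) by (simp add: sublist_Cons_right)
  then have "stack_link \<sigma> \<pi> (set out) b a" using reach_link_aux[OF r assms(2)] by blast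
  moreover have "set out \<subseteq> set (popped \<sigma> \<pi> [])" using reach_popped[OF r] by (metis Un_iff set_append subsetI)
  ultimately have "stack_link \<sigma> \<pi> (set (popped \<sigma> \<pi> [])) b a" by (rule stack_link_mono)
  with b(2) ba ax ax' that show thesis by blast
qed

lemma popped_Nil_iff:
  assumes "distinct \<pi>" and "length \<sigma> \<ge> 2"
  shows "popped \<sigma> \<pi> [] = [] \<longleftrightarrow> \<not> contains_consecutive (rev \<sigma>) \<pi>"
proof
  assume p: "popped \<sigma> \<pi> [] = []"
  obtain st out where r: "reach \<sigma> \<pi> [] st out" using reach_end by blast
  then have "out = []" using reach_popped[OF r] p by simp
  then have "st = rev \<pi>" using reach_stack[OF r assms(1)] by auto
  then show "\<not> contains_consecutive (rev \<sigma>) \<pi>"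
    using reach_no_occurrence[OF r assms(2)] by (simp add: contains_consecutive_rev)
next
  have "popped \<sigma> inp st = []" if "\<not> contains_consecutive \<sigma> (rev inp @ st)" for inp st
    using that
  proof (induction \<sigma> inp st rule: popped.induct)
    case (3 \<sigma> x inp s st)
    then have "\<not> contains_consecutive \<sigma> (x # s # st)"
      using contains_consecutive_append[of \<sigma> "x # s # st" "rev inp"] by auto
    then show ?case using 3 by auto
  qed auto
  from this[of \<pi> "[]"] show "\<not> contains_consecutive (rev \<sigma>) \<pi> \<Longrightarrow> popped \<sigma> \<pi> [] = []"
    by (simp add: contains_consecutive_rev)
qed

lemma SC_eq_rev: "distinct \<pi> \<Longrightarrow> popped \<sigma> \<pi> [] = [] \<Longrightarrow> SC \<sigma> \<pi> = rev \<pi>"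
  using SC_split[of \<pi> \<sigma>] by simp

section \<open>Cycles\<close>

text \<open>Going around the cycle also reaches the times before \<open>s\<close>.\<close>

lemma cycle_invariant:
  fixes c :: "nat \<Rightarrow> 'a"
  assumes "p \<ge> 1" and "\<And>t. c (t + p) = c t" and "\<And>t. P (c t) \<Longrightarrow> P (c (Suc t))" and "P (c s)"
  shows "P (c t)"
proof -
  have "P (c (s + j))" for j using assms(3,4) by (induction j) auto
  moreover have "c (t + j * p) = c t" for j
    by (induction j) (simp_all add: assms(2) add.assoc[symmetric] add.commute[of p])
  moreover have "t + s * p = s + (t + s * p - s)"
    using assms(1) by (cases p) auto
  ultimately show ?thesis by metis
qed

locale SC_cycle =
  fixes \<sigma> :: "nat list" and c :: "nat \<Rightarrow> nat list" and p :: nat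
  assumes length_\<sigma>: "length \<sigma> \<ge> 3" and distinct_\<sigma>: "distinct \<sigma>"
    and p: "p \<ge> 1" and period: "\<And>t. c (t + p) = c t"
    and step: "\<And>t. c (Suc t) = SC \<sigma> (c t)"
    and distinct_c: "\<And>t. distinct (c t)"
begin

abbreviation Pop :: "nat \<Rightarrow> nat set" where
  "Pop t \<equiv> set (popped \<sigma> (c t) [])"

definition mobile :: "nat set" where "mobile = (\<Union>t. Pop t)"

definition frame :: "nat set" where "frame = set (c 0) - mobile"

lemma set_c: "set (c t) = set (c 0)"
  by (induction t) (simp_all add: step set_SC)

lemma Pop_in_mobile: "a \<in> Pop t \<Longrightarrow> a \<in> mobile"
  unfolding mobile_def by blast

lemma mobile_subset: "mobile \<subseteq> set (c 0)"
proof
  fix a assume "a \<in> mobile"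
  then obtain t where "a \<in> Pop t" unfolding mobile_def by blast
  then have "a \<in> set (c (Suc t))" using SC_split[OF distinct_c, of \<sigma> t] step by simp
  then show "a \<in> set (c 0)" using set_c by blast
qed

lemma popped_first:
  assumes "a \<in> Pop t" and "v \<in> set (c 0)" and "v \<notin> Pop t"
  shows "precedes (c (Suc t)) a v"
  unfolding step SC_split[OF distinct_c, of \<sigma> t]
  using assms set_c[of t] by (intro precedes_append) auto

lemma unpopped_reversed:
  assumes "u \<notin> Pop t" and "v \<notin> Pop t"
  shows "precedes (c (Suc t)) u v \<longleftrightarrow> precedes (c t) v u"
proof -
  let ?F = "filter (\<lambda>v. v \<notin> Pop t) (rev (c t))"
  have eq: "c (Suc t) = popped \<sigma> (c t) [] @ ?F"
    using step SC_split[OF distinct_c] by metis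
  have "precedes (c (Suc t)) u v \<longleftrightarrow> precedes ?F u v"
  proof
    assume *: "precedes (c (Suc t)) u v"
    then have "u \<in> set ?F" using precedes_in_set[OF *] eq assms(1) by auto
    then show "precedes ?F u v"
      using * precedes_appendD[of "popped \<sigma> (c t) []" ?F u v] distinct_c[of "Suc t"] eq by simp
  next
    assume "precedes ?F u v"
    then show "precedes (c (Suc t)) u v"
      unfolding eq precedes_def by (metis Un_iff append.assoc set_append)
  qed
  also have "\<dots> \<longleftrightarrow> precedes (c t) v u"
    using assms by (simp add: precedes_filter precedes_rev)
  finally show ?thesis .
qed

definition outer :: "nat \<Rightarrow> nat list \<Rightarrow> bool" where
  "outer m xs \<longleftrightarrow> (\<forall>v\<in>frame. precedes xs m v) \<or> (\<forall>v\<in>frame. precedes xs v m)"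

text \<open>A premature pop puts \<open>m\<close> before the whole frame. Without such a pop, a step reverses the
  position of \<open>m\<close> relative to each frame entry, so that before and after are exchanged.\<close>

lemma mobile_outer:
  assumes "m \<in> mobile"
  shows "outer m (c t)"
proof -
  have after: "outer m (c (Suc t))" if "m \<in> Pop t" for t
    using popped_first[OF that] unfolding outer_def frame_def by (auto simp: mobile_def)
  obtain s where s: "m \<in> Pop s" using assms unfolding mobile_def by blast
  show ?thesis
  proof (rule cycle_invariant[where c = c and p = p and P = "outer m" and s = "Suc s", OF p period])
    show "outer m (c (Suc s))" by (rule after[OF s])
    fix t assume o: "outer m (c t)"
    show "outer m (c (Suc t))"
    proof (cases "m \<in> Pop t")
      case True
      then show ?thesis by (rule after)
    next
      case False
      have "v \<notin> Pop t" if "v \<in> frame" for v using that unfolding frame_def mobile_def by blast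
      then show ?thesis using o False unpopped_reversed unfolding outer_def by blast
    qed
  qed
qed

lemma outer_before:
  assumes "m \<in> mobile" and "x \<in> frame" and "precedes (c t) m x" and "v \<in> frame"
  shows "precedes (c t) m v"
  using mobile_outer[OF assms(1), of t] assms(2-4) precedes_asym[OF distinct_c] unfolding outer_def by blast

lemma outer_after:
  assumes "m \<in> mobile" and "x \<in> frame" and "precedes (c t) x m" and "v \<in> frame"
  shows "precedes (c t) v m"
  using mobile_outer[OF assms(1), of t] assms(2-4) precedes_asym[OF distinct_c] unfolding outer_def by blast

text \<open>Comparing entries through \<open>sg\<close> amounts to complementing all values if \<open>\<sigma>\<close> begins with a
  descent. Both signs of the first step of \<open>\<sigma>\<close> are thus treated as an ascent.\<close>

definition sg :: "nat \<Rightarrow> int" where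
  "sg v = (if \<sigma> ! 0 < \<sigma> ! 1 then int v else - int v)"

lemma inj_sg: "inj_on sg A"
  by (auto simp: inj_on_def sg_def split: if_splits)

lemma pattern_sg:
  assumes "same_relative_order [x, a, b] (take 3 \<sigma>)"
  shows "sg x < sg a" and "sg a < sg b \<longleftrightarrow> sg (\<sigma> ! 1) < sg (\<sigma> ! 2)"
proof -
  have r: "[x, a, b] ! i < [x, a, b] ! j \<longleftrightarrow> \<sigma> ! i < \<sigma> ! j" if "i < 3" "j < 3" for i j
    using assms that length_\<sigma> unfolding same_relative_order_def by auto
  have "\<sigma> ! 0 \<noteq> \<sigma> ! 1" using distinct_\<sigma> length_\<sigma>
    by (subst nth_eq_iff_index_eq) auto
  then show "sg x < sg a" using r[of 0 1] r[of 1 0] by (auto simp: sg_def)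
  show "sg a < sg b \<longleftrightarrow> sg (\<sigma> ! 1) < sg (\<sigma> ! 2)"
    using r[of 1 2] r[of 2 1] by (auto simp: sg_def numeral_2_eq_2)
qed

lemma event:
  assumes "a \<in> Pop t"
  obtains x b where "same_relative_order [x, a, b] (take 3 \<sigma>)" and "sg x < sg a"
    and "precedes (c t) b a" and "precedes (c t) a x" and "precedes (c (Suc t)) a x"
    and "stack_link \<sigma> (c t) (Pop t) b a" and "x \<in> mobile \<union> frame" and "b \<in> mobile \<union> frame"
proof -
  obtain x b where e: "same_relative_order [x, a, b] (take 3 \<sigma>)"
    "precedes (c t) b a" "precedes (c t) a x" "precedes (c (Suc t)) a x"
    "stack_link \<sigma> (c t) (Pop t) b a"
    using popped_event[OF distinct_c length_\<sigma> assms] unfolding step by blast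
  have "x \<in> set (c 0)" "b \<in> set (c 0)"
    using precedes_in_set[OF e(2)] precedes_in_set[OF e(3)] set_c[of t] by auto
  then have "x \<in> mobile \<union> frame" "b \<in> mobile \<union> frame" by (auto simp: frame_def)
  with e pattern_sg(1)[OF e(1)] show thesis by (intro that)
qed

text \<open>The least mobile entry \<open>m\<close> can be popped only because of a frame entry. Then \<open>m\<close> and
  everything before it lies before the frame, so the stack entry below \<open>m\<close> is mobile and
  exceeds \<open>m\<close>.\<close>

lemma pattern_second_ascent:
  assumes "mobile \<noteq> {}"
  shows "sg (\<sigma> ! 1) < sg (\<sigma> ! 2)"
proof -
  have fin: "finite mobile" using mobile_subset finite_subset by blast
  obtain m where m: "m \<in> mobile" and min: "\<And>v. v \<in> mobile \<Longrightarrow> sg m \<le> sg v"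
    using fin assms by (metis arg_min_if_finite(1) arg_min_least)
  obtain t where "m \<in> Pop t" using m unfolding mobile_def by blast
  then obtain x b where e: "same_relative_order [x, m, b] (take 3 \<sigma>)" "sg x < sg m"
    "precedes (c t) b m" "precedes (c t) m x" "x \<in> mobile \<union> frame" "b \<in> mobile \<union> frame"
    using event by metis
  have "x \<in> frame" using e(2,5) min by fastforce
  have "b \<notin> frame" using outer_before[OF m \<open>x \<in> frame\<close> e(4)] e(3) precedes_asym[OF distinct_c] by blast
  then have "sg m \<le> sg b" using e(6) min by blast
  moreover have "m \<noteq> b" using e(3) precedes_asym[OF distinct_c] by blast
  ultimately have "sg m < sg b" using inj_sg by (metis inj_onD UNIV_I order_le_less)
  then show ?thesis using pattern_sg(2)[OF e(1)] by simp
qed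

text \<open>The greatest mobile entry \<open>\<mu>\<close> is popped only when it is adjacent to a frame entry \<open>b\<close>. This
  adjacency is lost by the pop, and no step restores it.\<close>

lemma mobile_empty: "mobile = {}"
proof (rule ccontr)
  assume ne: "mobile \<noteq> {}"
  have fin: "finite mobile" using mobile_subset finite_subset by blast
  have asc: "sg x < sg y \<and> sg y < sg z" if "same_relative_order [x, y, z] (take 3 \<sigma>)" for x y z
    using pattern_sg[OF that] pattern_second_ascent[OF ne] by simp
  have "Max (sg ` mobile) \<in> sg ` mobile" using fin ne by simp
  then obtain \<mu> where \<mu>: "\<mu> \<in> mobile" "sg \<mu> = Max (sg ` mobile)" by force
  then have max: "\<And>v. v \<in> mobile \<Longrightarrow> sg v \<le> sg \<mu>" using fin by simp
  have mu_event: "\<exists>x b. x \<in> mobile \<and> b \<in> frame \<and> sg \<mu> < sg b \<and> precedes (c t) b \<mu> \<and> precedes (c t) \<mu> x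
      \<and> precedes (c (Suc t)) \<mu> x \<and> sublist [b, \<mu>] (c t)"
    if pop: "\<mu> \<in> Pop t" for t
  proof -
    obtain x b where e: "same_relative_order [x, \<mu>, b] (take 3 \<sigma>)"
      "precedes (c t) b \<mu>" "precedes (c t) \<mu> x" "precedes (c (Suc t)) \<mu> x"
      "stack_link \<sigma> (c t) (Pop t) b \<mu>" "x \<in> mobile \<union> frame" "b \<in> mobile \<union> frame"
      using event[OF pop] by metis
    have "b \<in> frame" using asc[OF e(1)] e(7) max by fastforce
    have "x \<in> mobile"
      using outer_after[OF \<mu>(1) \<open>b \<in> frame\<close> e(2)] e(3,6) precedes_asym[OF distinct_c] by blast
    have "sublist [b, \<mu>] (c t)"
    proof -
      have "\<not> same_relative_order [\<mu>, y, b] (take 3 \<sigma>)" if "y \<in> Pop t" for y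
        using asc[of \<mu> y b] max[OF Pop_in_mobile[OF that]] by auto
      then show ?thesis using e(5) unfolding stack_link_def by blast
    qed
    with e asc[OF e(1)] \<open>b \<in> frame\<close> \<open>x \<in> mobile\<close> show ?thesis by blast
  qed
  obtain s where s: "\<mu> \<in> Pop s" using \<mu>(1) unfolding mobile_def by blast
  obtain b where b: "b \<in> frame" "sg \<mu> < sg b" "sublist [b, \<mu>] (c s)"
    using mu_event[OF s] by blast
  \<comment> \<open>Both orders are needed because a step without a pop of \<open>\<mu>\<close> exchanges \<open>b\<close> and \<open>\<mu>\<close>.\<close>
  define adj where "adj xs \<longleftrightarrow> sublist [b, \<mu>] xs \<or> sublist [\<mu>, b] xs" for xs
  have b_unpopped: "b \<notin> Pop t" for t using b(1) unfolding frame_def mobile_def by blast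
  have b_set: "b \<in> set (c 0)" using b(1) unfolding frame_def by blast
  have popped_not_adj: "\<not> adj (c (Suc t))" if pop: "\<mu> \<in> Pop t" for t
  proof
    assume a: "adj (c (Suc t))"
    obtain x b' where x: "x \<in> mobile" "b' \<in> frame" "precedes (c t) b' \<mu>" "precedes (c t) \<mu> x"
      "precedes (c (Suc t)) \<mu> x"
      using mu_event[OF pop] by blast
    \<comment> \<open>Since \<open>x\<close> comes out after \<open>\<mu>\<close>, adjacency would put \<open>x\<close> after \<open>b\<close>. But \<open>x\<close> is after \<open>b\<close> in the
      input, so it comes out before \<open>b\<close>, popped or not.\<close>
    have mb: "precedes (c (Suc t)) \<mu> b" using popped_first[OF pop b_set b_unpopped] .
    then have "sublist [\<mu>, b] (c (Suc t))"
      using a sublist_pair_precedes[of b \<mu> "c (Suc t)"] precedes_asym[OF distinct_c mb]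
      unfolding adj_def by blast
    moreover have "x \<noteq> b" using x(1) b(1) unfolding frame_def by blast
    ultimately have bx: "precedes (c (Suc t)) b x"
      using sublist_pair_next[OF distinct_c _ x(5)] by blast
    have "x \<notin> Pop t"
      using popped_first[OF _ b_set b_unpopped] precedes_asym[OF distinct_c bx] by blast
    then have "precedes (c t) x b" using bx unpopped_reversed[OF b_unpopped] by blast
    moreover have "precedes (c t) b x"
    proof -
      have "precedes (c t) b \<mu>" using outer_after[OF \<mu>(1) x(2,3) b(1)] .
      then show ?thesis using precedes_trans[OF distinct_c _ x(4)] by blast
    qed
    ultimately show False using precedes_asym[OF distinct_c[of t]] by blast
  qed
  have "\<not> adj (c s)"
  proof (rule cycle_invariant[where c = c and p = p and P = "\<lambda>xs. \<not> adj xs" and s = "Suc s", OF p period])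
    show "\<not> adj (c (Suc s))" by (rule popped_not_adj[OF s])
    fix t assume na: "\<not> adj (c t)"
    show "\<not> adj (c (Suc t))"
    proof (cases "\<mu> \<in> Pop t")
      case True
      then show ?thesis by (rule popped_not_adj)
    next
      case False
      show ?thesis
      proof
        assume "adj (c (Suc t))"
        then have "stack_link \<sigma> (c t) (Pop t) b \<mu> \<or> stack_link \<sigma> (c t) (Pop t) \<mu> b"
          using SC_link[OF distinct_c[of t] length_\<sigma>] False b_unpopped[of t]
          unfolding adj_def step by blast
        \<comment> \<open>The stack entries \<open>b\<close> and \<open>\<mu>\<close> did not become neighbours by a pop of some \<open>y\<close>: with \<open>b\<close>
          below, \<open>y\<close> would be a mobile entry greater than \<open>\<mu>\<close>; with \<open>b\<close> on top, \<open>b < y < \<mu>\<close>.\<close>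
        moreover have "\<not> same_relative_order [\<mu>, y, b] (take 3 \<sigma>)" if "y \<in> Pop t" for y
          using asc[of \<mu> y b] max[OF Pop_in_mobile[OF that]] by auto
        moreover have "\<not> same_relative_order [b, y, \<mu>] (take 3 \<sigma>)" for y
          using asc[of b y \<mu>] b(2) by auto
        ultimately have "adj (c t)"
          unfolding stack_link_def adj_def by blast
        with na show False by simp
      qed
    qed
  qed
  then show False using b(3) unfolding adj_def by simp
qed

lemma avoids: "\<not> contains_consecutive (rev \<sigma>) (c t) \<and> \<not> contains_consecutive \<sigma> (c t)"
proof -
  have pop: "popped \<sigma> (c t) [] = []" for t
    using mobile_empty unfolding mobile_def by simp
  have r: "\<not> contains_consecutive (rev \<sigma>) (c t)" for t
    using pop popped_Nil_iff[OF distinct_c] length_\<sigma> by auto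
  have "c (Suc t) = rev (c t)" using SC_eq_rev[OF distinct_c pop] step by simp
  then have "\<not> contains_consecutive \<sigma> (c t)"
    using r[of "Suc t"] by (simp add: contains_consecutive_rev)
  with r show ?thesis by blast
qed

end

theorem theorem1p1:
  fixes k n :: nat and \<sigma> :: "nat list"
  assumes "k \<ge> 3" and "\<sigma> \<in> perms k" and "n \<ge> 1"
  shows "periodic_points (SC \<sigma>) (perms n) = Av n {\<sigma>, rev \<sigma>}"
proof -
  have \<sigma>: "distinct \<sigma>" "length \<sigma> \<ge> 3"
    using assms by (auto simp: permutations_of_set_def dest: distinct_card)
  show ?thesis
  proof (intro set_eqI iffI)
    fix \<pi> assume "\<pi> \<in> periodic_points (SC \<sigma>) (perms n)"
    then obtain p where \<pi>: "\<pi> \<in> perms n" and p: "p \<ge> 1" "(SC \<sigma> ^^ p) \<pi> = \<pi>"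
      unfolding periodic_points_def by blast
    have perm: "(SC \<sigma> ^^ t) \<pi> \<in> perms n" for t
      using \<pi> SC_in_perms by (induction t) auto
    interpret SC_cycle \<sigma> "\<lambda>t. (SC \<sigma> ^^ t) \<pi>" p
    proof
      show "(SC \<sigma> ^^ (t + p)) \<pi> = (SC \<sigma> ^^ t) \<pi>" for t using p(2) by (simp add: funpow_add)
      show "distinct ((SC \<sigma> ^^ t) \<pi>)" for t using perm by (simp add: permutations_of_set_def)
    qed (use \<sigma> p in auto)
    show "\<pi> \<in> Av n {\<sigma>, rev \<sigma>}" using avoids[of 0] \<pi> by (simp add: Av_def)
  next
    fix \<pi> assume "\<pi> \<in> Av n {\<sigma>, rev \<sigma>}"
    then have \<pi>: "\<pi> \<in> perms n" "\<not> contains_consecutive \<sigma> \<pi>" "\<not> contains_consecutive (rev \<sigma>) \<pi>"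
      by (auto simp: Av_def)
    have d: "distinct \<pi>" using \<pi>(1) by (simp add: permutations_of_set_def)
    have "SC \<sigma> \<pi> = rev \<pi>" using SC_eq_rev popped_Nil_iff \<pi>(3) d \<sigma>(2) by simp
    moreover have "SC \<sigma> (rev \<pi>) = \<pi>"
      using SC_eq_rev[of "rev \<pi>"] popped_Nil_iff[of "rev \<pi>"] \<pi>(2) d \<sigma>(2)
      by (simp add: contains_consecutive_rev)
    ultimately have "(SC \<sigma> ^^ 2) \<pi> = \<pi>" by (simp add: numeral_2_eq_2)
    then show "\<pi> \<in> periodic_points (SC \<sigma>) (perms n)"
      using \<pi>(1) unfolding periodic_points_def by (auto intro!: exI[of _ 2])
  qed
qed

end
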